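(* For the BGK equation $\partial_t f+\mathbf v\cdot\nabla_{\mathbf x}f=\frac1{\varepsilon}(M_{\mathbf U}-f)$, consider the numerical scheme (S1)–(S4) (a nodal discontinuous Galerkin, implicit-explicit Runge–Kutta scheme for its 1d2v form, given in the context) equipped with the quadrature corrected moments (also given in the context). In the asymptotic limit $\varepsilon\to0$, the numerical solution for the distribution function, whose nodal values at the new time are $(\mathbf C^i_p)^{(2)}$, converges to the corrected local Maxwellian $\widetilde{\mathbf M}_{\mathbf U}(x^i_p,t^{(2)})$ for all $1\le i\le N_x$ and $1\le p\le k+1$.
   Context: **Equation.** In 1d2v form the BGK equation is $\partial_t f+v_x\partial_x f=\frac1{\varepsilon}(M_{\mathbf U}-f)$ for $f=f(x,v_x,v_y,t)$, with $x\in\Omega_x=[a,b]$ and $(v_x,v_y)\in\Omega_v=[-V_{\max},V_{\max}]^2$, with appropriate boundary conditions prescribed. The Knudsen number $\varepsilon=\varepsilon(x)>0$ may depend on $x$. $M_{\mathbf U}=\frac{n}{(2\pi T)^{d/2}}\exp\big(-\frac{|\mathbf v-\mathbf u|^2}{2T}\big)$ is the local Maxwellian ($d$ is the number of velocity dimensions, $d=2$ in the 1d2v form), where the density $n$, bulk velocity $\mathbf u=(u_x,u_y)$ and temperature $T$ are determined by the moments of $f$: $\mathbf U=(n,n\mathbf u,E)^T=\int(1,\mathbf v,|\mathbf v|^2/2)^Tf\,dv$, $E=(n|\mathbf u|^2+dnT)/2$. **Mesh and nodal basis.** $\Omega_x$ is split into $N_x$ intervals $I_i$ of equal length $h_x$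 with centers $x_i$. Let $k\ge0$ be an integer, let $\xi_1,\dots,\xi_{k+1}$ and $w_1,\dots,w_{k+1}$ be the Gauss–Legendre nodes and weights on the reference element $[-\frac12,\frac12]$, let $L_q(\xi)=\prod_{s\ne q}\frac{\xi-\xi_s}{\xi_q-\xi_s}$ be the associated Lagrange polynomials, and let $x^i_p=x_i+h_x\xi_p$. Write $\varepsilon^i_p=\varepsilon(x^i_p)$; the limit $\varepsilon\to0$ entails $\varepsilon^i_p\to0$. **Velocity grid.** $\mathbf v_x=(v_{x,1},\dots,v_{x,N_v})$ and $\mathbf v_y=(v_{y,1},\dots,v_{y,N_v})$ are uniform grids with common spacing $h_v$. For each $i,p$, the matrix $\mathbf C^i_p\in\mathbb R^{N_v\times N_v}$ stores at entry $(m,n)$ the coefficient of the numerical solution on $I_i$ associated with $L_p$ at velocity $(v_{x,m},v_{y,n})$; because the basis is nodal, it coincides with the nodal value of the numerical distribution function at $(x^i_p,v_{x,m},v_{y,n})$. For a matrix $\mathbf G\in\mathbb R^{N_v\times N_v}$ let $\langle\mathbf G\rangle=h_v^2\sum_{m,n}\mathbf G_{mn}$ be the discrete velocity integral (Riemann sum); a function $g(v_x,v_y)$ multiplying a matrix acts entrywise, multiplying entry $(m,n)$ by $g(v_{x,m},v_{y,n})$. Write $v_x^+=\max(v_x,0)$, $v_x^-=\min(v_x,0)$. **Upwind transport terms** (for each element $i$; values from outside the mesh are supplied by the boundary conditions). $$\mathcal F^p_+=-\frac{v_x^+}{h_xw_p}\sum_{q=1}^{k+1}\Big(\mathbf C^i_qL_q(\tfrac12)L_p(\tfrac12)-\mathbf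 C^{i-1}_qL_q(\tfrac12)L_p(-\tfrac12)-\mathbf C^i_qw_qL_p'(\xi_q)\Big),$$ $$\mathcal F^p_-=-\frac{v_x^-}{h_xw_p}\sum_{q=1}^{k+1}\Big(\mathbf C^{i+1}_qL_q(-\tfrac12)L_p(\tfrac12)-\mathbf C^i_qL_q(-\tfrac12)L_p(-\tfrac12)-\mathbf C^i_qw_qL_p'(\xi_q)\Big).$$ **Discrete moments and moment fluxes.** $\mathbf U^i_p=(n^i_p,(nu_x)^i_p,(nu_y)^i_p,E^i_p)^T$ denotes the discrete moments at the nodes, with $(\mathbf U^i_p)^{(0)}=\langle(1,v_x,v_y,\frac{v_x^2+v_y^2}2)^T(\mathbf C^i_p)^{(0)}\rangle$. With $\mathbf F^{i,\pm}_q=\langle v_x^\pm(1,v_x,v_y,\frac{v_x^2+v_y^2}2)^T\mathbf C^i_q\rangle$, $$\mathbf P^+_p=-\frac1{h_xw_p}\sum_{q=1}^{k+1}\Big(\mathbf F^{i,+}_qL_q(\tfrac12)L_p(\tfrac12)-\mathbf F^{i-1,+}_qL_q(\tfrac12)L_p(-\tfrac12)-\mathbf F^{i,+}_qw_qL_p'(\xi_q)\Big),$$ $$\mathbf P^-_p=-\frac1{h_xw_p}\sum_{q=1}^{k+1}\Big(\mathbf F^{i+1,-}_qL_q(-\tfrac12)L_p(\tfrac12)-\mathbf F^{i,-}_qL_q(-\tfrac12)L_p(-\tfrac12)-\mathbf F^{i,-}_qw_qL_p'(\xi_q)\Big).$$ Superscripts $(0)$, $(1)$ on $\mathcal F^p_\pm$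 and $\mathbf P^\pm_p$ mean evaluation with the coefficients $(\mathbf C)^{(0)}$, $(\mathbf C)^{(1)}$. **Corrected local Maxwellian (quadrature corrected moments, QCM).** At each node $x^i_p$ and stage $s\in\{1,2\}$, $\widetilde{\mathbf M}_{\mathbf U}(x^i_p,t^{(s)})\in\mathbb R^{N_v\times N_v}$ is the rank-1 matrix with entries $$\frac{n_M}{2\pi T_M}\exp\Big(-\frac{(v_{x,m}-u_{x,M})^2}{2T_M}\Big)\exp\Big(-\frac{(v_{y,n}-u_{y,M})^2}{2T_M}\Big),$$ where the quadrature corrected moments $(n_M,u_{x,M},u_{y,M},T_M)$ are obtained by solving the nonlinear system $\langle(1,v_x,v_y,\frac{v_x^2+v_y^2}2)^T\widetilde{\mathbf M}_{\mathbf U}(x^i_p,t^{(s)})\rangle=(\mathbf U^i_p)^{(s)}$, so that the discrete mass, momentum and energy of the Maxwellian match the moments $(\mathbf U^i_p)^{(s)}$ exactly. **Scheme.** The solution is updated from $t^\ell$ to $t^{\ell+1}=t^\ell+\Delta t$. With $\gamma=1-\frac{\sqrt2}2$, $\delta=1-\frac1{2\gamma}$, $t^{(0)}=t^\ell$, $t^{(1)}=t^\ell+\gamma\Delta t$, $t^{(2)}=t^{\ell+1}$, where superscripts denote numerical solutions at these stages, for all $i,p$: (S1) $(\mathbf U^i_p)^{(1)}=(\mathbf U^i_p)^{(0)}+\gamma\Delta t(\mathbf P^+_p+\mathbf P^-_p)^{(0)}$ (S2) $(\mathbf C^i_p)^{(1)}=(\mathbf C^i_p)^{(0)}+\gamma\Delta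 t(\mathcal F^p_++\mathcal F^p_-)^{(0)}+\frac{\gamma\Delta t}{\varepsilon^i_p}\big(\widetilde{\mathbf M}_{\mathbf U}(x^i_p,t^{(1)})-(\mathbf C^i_p)^{(1)}\big)$ (S3) $(\mathbf U^i_p)^{(2)}=(\mathbf U^i_p)^{(0)}+\delta\Delta t(\mathbf P^+_p+\mathbf P^-_p)^{(0)}+(1-\delta)\Delta t(\mathbf P^+_p+\mathbf P^-_p)^{(1)}$ (S4) $(\mathbf C^i_p)^{(2)}=(\mathbf C^i_p)^{(0)}+\delta\Delta t(\mathcal F^p_++\mathcal F^p_-)^{(0)}+(1-\delta)\Delta t(\mathcal F^p_++\mathcal F^p_-)^{(1)}+\frac{(1-\gamma)\Delta t}{\varepsilon^i_p}\big(\widetilde{\mathbf M}_{\mathbf U}(x^i_p,t^{(1)})-(\mathbf C^i_p)^{(1)}\big)+\frac{\gamma\Delta t}{\varepsilon^i_p}\big(\widetilde{\mathbf M}_{\mathbf U}(x^i_p,t^{(2)})-(\mathbf C^i_p)^{(2)}\big)$ *)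

theory Defs
  imports "HOL-Analysis.Analysis" "HOL-Computational_Algebra.Polynomial"
begin

(* Rodrigues' formula after the substitution x = 2 xi:
   legendre_ref n is the polynomial xi |-> P_n(2 xi). *)
definition legendre_ref :: "nat \<Rightarrow> real poly" where
  "legendre_ref n = smult (1 / fact n) ((pderiv ^^ n) ([:- (1/4), 0, 1:] ^ n))"

definition lagrange_basis :: "nat \<Rightarrow> (nat \<Rightarrow> real) \<Rightarrow> nat \<Rightarrow> real poly" where
  "lagrange_basis k \<xi> q = (\<Prod>s\<in>{1..k+1} - {q}. smult (1 / (\<xi> q - \<xi> s)) [:- \<xi> s, 1:])"

definition gauss_legendre :: "nat \<Rightarrow> (nat \<Rightarrow> real) \<Rightarrow> (nat \<Rightarrow> real) \<Rightarrow> bool" where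
  "gauss_legendre k \<xi> w \<longleftrightarrow>
     bij_betw \<xi> {1..k+1} {x. poly (legendre_ref (k+1)) x = 0} \<and>
     (\<forall>q\<in>{1..k+1}. w q = integral {-(1/2)..1/2} (poly (lagrange_basis k \<xi> q)))"

(* All indices (elements, nodes, velocity grid points) start at 1. *)
record discretization =
  x_left :: real
  x_right :: real
  num_x :: nat
  degr :: nat
  ref_node :: "nat \<Rightarrow> real"
  ref_weight :: "nat \<Rightarrow> real"
  V_max :: real
  num_v :: nat
  h_v :: real
  v_x :: "nat \<Rightarrow> real"
  v_y :: "nat \<Rightarrow> real"

definition uniform_grid :: "nat \<Rightarrow> real \<Rightarrow> real \<Rightarrow> (nat \<Rightarrow> real) \<Rightarrow> bool" where
  "uniform_grid N V h v \<longleftrightarrow>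
     (\<forall>m\<in>{1..N}. v m = v 1 + (real m - 1) * h \<and> v m \<in> {-V..V})"

definition valid_discretization :: "discretization \<Rightarrow> bool" where
  "valid_discretization D \<longleftrightarrow>
     x_left D < x_right D \<and> num_x D \<ge> 1 \<and>
     gauss_legendre (degr D) (ref_node D) (ref_weight D) \<and>
     V_max D > 0 \<and> num_v D \<ge> 1 \<and> h_v D > 0 \<and>
     uniform_grid (num_v D) (V_max D) (h_v D) (v_x D) \<and>
     uniform_grid (num_v D) (V_max D) (h_v D) (v_y D)"

definition elements :: "discretization \<Rightarrow> nat set" where
  "elements D = {1..num_x D}"

definition nodes :: "discretization \<Rightarrow> nat set" where
  "nodes D = {1..degr D + 1}"

definition vgrid :: "discretization \<Rightarrow> nat set" where
  "vgrid D = {1..num_v D}"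

definition h_x :: "discretization \<Rightarrow> real" where
  "h_x D = (x_right D - x_left D) / real (num_x D)"

definition x_center :: "discretization \<Rightarrow> nat \<Rightarrow> real" where
  "x_center D i = x_left D + (real i - 1/2) * h_x D"

definition x_node :: "discretization \<Rightarrow> nat \<Rightarrow> nat \<Rightarrow> real" where
  "x_node D i p = x_center D i + h_x D * ref_node D p"

abbreviation L_basis :: "discretization \<Rightarrow> nat \<Rightarrow> real poly" where
  "L_basis D \<equiv> lagrange_basis (degr D) (ref_node D)"

type_synonym vmat = "nat \<Rightarrow> nat \<Rightarrow> real"

(* C i p m n: element i, node p, velocity (v_x m, v_y n).
   Only index values in elements, nodes and vgrid are meaningful. *)
type_synonym coeffs = "nat \<Rightarrow> nat \<Rightarrow> vmat"

(* density, the two momentum components, energy *)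
type_synonym moments = "real \<times> real \<times> real \<times> real"

definition vel_sum :: "discretization \<Rightarrow> (nat \<Rightarrow> nat \<Rightarrow> 'b::real_vector) \<Rightarrow> 'b" where
  "vel_sum D G = (h_v D)\<^sup>2 *\<^sub>R (\<Sum>m\<in>vgrid D. \<Sum>n\<in>vgrid D. G m n)"

definition invariants :: "real \<Rightarrow> real \<Rightarrow> moments" where
  "invariants vx vy = (1, vx, vy, (vx\<^sup>2 + vy\<^sup>2) / 2)"

definition moments_of :: "discretization \<Rightarrow> vmat \<Rightarrow> moments" where
  "moments_of D G = vel_sum D (\<lambda>m n. G m n *\<^sub>R invariants (v_x D m) (v_y D n))"

definition flux_plus :: "discretization \<Rightarrow> vmat \<Rightarrow> moments" where
  "flux_plus D G =
     vel_sum D (\<lambda>m n. (max (v_x D m) 0 * G m n) *\<^sub>R invariants (v_x D m) (v_y D n))"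

definition flux_minus :: "discretization \<Rightarrow> vmat \<Rightarrow> moments" where
  "flux_minus D G =
     vel_sum D (\<lambda>m n. (min (v_x D m) 0 * G m n) *\<^sub>R invariants (v_x D m) (v_y D n))"

(* A boundary condition B supplies, from the interior coefficients, the
   coefficients on the two ghost elements 0 and num_x D + 1 (e.g. prescribed
   inflow data, periodic, outflow or reflecting walls). *)
type_synonym boundary_condition = "coeffs \<Rightarrow> coeffs"

definition with_ghosts :: "discretization \<Rightarrow> boundary_condition \<Rightarrow> coeffs \<Rightarrow> coeffs" where
  "with_ghosts D B C = (\<lambda>i. if i \<in> elements D then C i else B C i)"

(* Bounded interior values produce bounded ghost values. *)
definition admissible_bc :: "discretization \<Rightarrow> boundary_condition \<Rightarrow> bool" where
  "admissible_bc D B \<longleftrightarrow>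
     (\<forall>R. \<exists>K. \<forall>C.
        (\<forall>i\<in>elements D. \<forall>p\<in>nodes D. \<forall>m\<in>vgrid D. \<forall>n\<in>vgrid D. \<bar>C i p m n\<bar> \<le> R) \<longrightarrow>
        (\<forall>i\<in>{0, num_x D + 1}. \<forall>p\<in>nodes D. \<forall>m\<in>vgrid D. \<forall>n\<in>vgrid D. \<bar>B C i p m n\<bar> \<le> K))"

(* dg_plus and dg_minus are the upwind discretizations of minus the
   x-derivative, for right- and left-going information.  They are linear in the
   nodal coefficients Z, and are used both for matrix entries and for moments. *)
definition dg_plus ::
  "discretization \<Rightarrow> (nat \<Rightarrow> nat \<Rightarrow> 'b::real_vector) \<Rightarrow> nat \<Rightarrow> nat \<Rightarrow> 'b" where
  "dg_plus D Z i p = (- 1 / (h_x D * ref_weight D p)) *\<^sub>R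
     (\<Sum>q\<in>nodes D.
        (poly (L_basis D q) (1/2) * poly (L_basis D p) (1/2)) *\<^sub>R Z i q
      - (poly (L_basis D q) (1/2) * poly (L_basis D p) (-(1/2))) *\<^sub>R Z (i - 1) q
      - (ref_weight D q * poly (pderiv (L_basis D p)) (ref_node D q)) *\<^sub>R Z i q)"

definition dg_minus ::
  "discretization \<Rightarrow> (nat \<Rightarrow> nat \<Rightarrow> 'b::real_vector) \<Rightarrow> nat \<Rightarrow> nat \<Rightarrow> 'b" where
  "dg_minus D Z i p = (- 1 / (h_x D * ref_weight D p)) *\<^sub>R
     (\<Sum>q\<in>nodes D.
        (poly (L_basis D q) (-(1/2)) * poly (L_basis D p) (1/2)) *\<^sub>R Z (i + 1) q
      - (poly (L_basis D q) (-(1/2)) * poly (L_basis D p) (-(1/2))) *\<^sub>R Z i q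
      - (ref_weight D q * poly (pderiv (L_basis D p)) (ref_node D q)) *\<^sub>R Z i q)"

(* In the next two definitions C includes the ghost elements. *)
definition transport :: "discretization \<Rightarrow> coeffs \<Rightarrow> nat \<Rightarrow> nat \<Rightarrow> vmat" where
  "transport D C i p m n =
     max (v_x D m) 0 * dg_plus D (\<lambda>j q. C j q m n) i p
   + min (v_x D m) 0 * dg_minus D (\<lambda>j q. C j q m n) i p"

definition moment_transport :: "discretization \<Rightarrow> coeffs \<Rightarrow> nat \<Rightarrow> nat \<Rightarrow> moments" where
  "moment_transport D C i p =
     dg_plus D (\<lambda>j q. flux_plus D (C j q)) i p
   + dg_minus D (\<lambda>j q. flux_minus D (C j q)) i p"

(* density n_M, bulk velocity u_xM, u_yM, temperature T_M *)
type_synonym maxwell_param = "real \<times> real \<times> real \<times> real"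

fun maxwellian :: "discretization \<Rightarrow> maxwell_param \<Rightarrow> vmat" where
  "maxwellian D (n\<^sub>M, ux, uy, T\<^sub>M) m n =
     n\<^sub>M / (2 * pi * T\<^sub>M)
     * exp (- ((v_x D m - ux)\<^sup>2) / (2 * T\<^sub>M))
     * exp (- ((v_y D n - uy)\<^sup>2) / (2 * T\<^sub>M))"

fun qcm :: "discretization \<Rightarrow> moments \<Rightarrow> maxwell_param \<Rightarrow> bool" where
  "qcm D U (n\<^sub>M, ux, uy, T\<^sub>M) \<longleftrightarrow>
     T\<^sub>M > 0 \<and> moments_of D (maxwellian D (n\<^sub>M, ux, uy, T\<^sub>M)) = U"

definition imex_gamma :: real where
  "imex_gamma = 1 - sqrt 2 / 2"

definition imex_delta :: real where
  "imex_delta = 1 - 1 / (2 * imex_gamma)"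

(* One time step of size dt.  Q1, Q2 are the quadrature corrected moments at
   stages 1 and 2; B0, B1 are the boundary conditions at stages 0 and 1.
   The update is implicit in C1 and C2. *)
definition imex_step ::
  "discretization \<Rightarrow> boundary_condition \<Rightarrow> boundary_condition \<Rightarrow> real \<Rightarrow> (real \<Rightarrow> real) \<Rightarrow>
   coeffs \<Rightarrow>
   (nat \<Rightarrow> nat \<Rightarrow> moments) \<Rightarrow> (nat \<Rightarrow> nat \<Rightarrow> maxwell_param) \<Rightarrow> coeffs \<Rightarrow>
   (nat \<Rightarrow> nat \<Rightarrow> moments) \<Rightarrow> (nat \<Rightarrow> nat \<Rightarrow> maxwell_param) \<Rightarrow> coeffs \<Rightarrow> bool" where
  "imex_step D B0 B1 dt \<epsilon> C0 U1 Q1 C1 U2 Q2 C2 \<longleftrightarrow>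
     (let \<gamma> = imex_gamma; \<delta> = imex_delta;
          G0 = with_ghosts D B0 C0; G1 = with_ghosts D B1 C1
      in \<forall>i\<in>elements D. \<forall>p\<in>nodes D.
        U1 i p = moments_of D (C0 i p) + (\<gamma> * dt) *\<^sub>R moment_transport D G0 i p \<and>
        qcm D (U1 i p) (Q1 i p) \<and>
        (\<forall>m\<in>vgrid D. \<forall>n\<in>vgrid D.
           C1 i p m n = C0 i p m n + \<gamma> * dt * transport D G0 i p m n
             + \<gamma> * dt / \<epsilon> (x_node D i p) * (maxwellian D (Q1 i p) m n - C1 i p m n)) \<and>
        U2 i p = moments_of D (C0 i p) + (\<delta> * dt) *\<^sub>R moment_transport D G0 i p
             + ((1 - \<delta>) * dt) *\<^sub>R moment_transport D G1 i p \<and>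
        qcm D (U2 i p) (Q2 i p) \<and>
        (\<forall>m\<in>vgrid D. \<forall>n\<in>vgrid D.
           C2 i p m n = C0 i p m n + \<delta> * dt * transport D G0 i p m n
             + (1 - \<delta>) * dt * transport D G1 i p m n
             + (1 - \<gamma>) * dt / \<epsilon> (x_node D i p) * (maxwellian D (Q1 i p) m n - C1 i p m n)
             + \<gamma> * dt / \<epsilon> (x_node D i p) * (maxwellian D (Q2 i p) m n - C2 i p m n)))"

end

theory Submission imports Defs begin

text \<open>
  At a fixed node write \<open>\<kappa> = \<gamma> dt\<close>.  Each implicit stage has the form
  \<open>C = X + (\<kappa> / \<epsilon>) (M - C)\<close> with \<open>M\<close> the corrected Maxwellian of that stage and \<open>X\<close>
  the terms already known, so that
  \<open>(\<kappa> / \<epsilon>) (M - C) = \<kappa> / (\<epsilon> + \<kappa>) (M - X)\<close>.  As soon as \<open>X\<close> and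
  \<open>M\<close> stay bounded for \<open>\<epsilon> \<rightarrow> 0\<close>, the stiff term on the left is bounded and therefore
  \<open>C - M\<close> tends to zero (\<open>relaxation_limit\<close>).  The whole proof consists of establishing
  these two bounds at both stages.

  The term \<open>X\<close> of the first stage involves only the bounded initial data.  The Maxwellian \<open>M\<close>
  is bounded by the very conservation property that defines the quadrature corrected
  moments: its entries have a common sign, hence the modulus of each is at most the modulus of
  the discrete density divided by \<open>h_v\<^sup>2\<close>, whatever the mean velocity and temperature that
  solve the nonlinear system (\<open>maxwellian_entry_le\<close>), and the density is bounded because it
  is updated explicitly.
  So the first stage relaxes, \<open>C1\<close> is bounded, and the first-stage stiff term, which
  reappears in the second stage with factor \<open>(1 - \<gamma>) / \<gamma>\<close>, is bounded too.  Hence the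
  \<open>X\<close> of the second stage is bounded as well, and the same argument applies to \<open>C2\<close>.

  Positivity of \<open>\<epsilon>\<close> at the nodes has to be derived from positivity on the interval: the
  Gauss nodes are by definition just the real roots of a Legendre polynomial, and one has to
  know that these lie in the reference element (\<open>legendre_ref_root_bound\<close>).
\<close>

section \<open>Location of the Gauss--Legendre nodes\<close>

lemma pcompose_power: "pcompose (p ^ n) q = pcompose p q ^ n"
  for p q :: "'a :: comm_semiring_1 poly"
  by (induction n) (simp_all only: power.simps pcompose_1 pcompose_mult)

lemma higher_pderiv_pcompose_linear:
  fixes p :: "'a :: {comm_semiring_1, semiring_no_zero_divisors, semiring_char_0} poly"
  shows "(pderiv ^^ j) (pcompose p [:c, d:]) = smult (d ^ j) (pcompose ((pderiv ^^ j) p) [:c, d:])"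
proof (induction j)
  case 0
  then show ?case by simp
next
  case (Suc j)
  then show ?case
    by (simp add: pderiv_smult pderiv_pcompose pderiv_pCons mult.commute)
qed

lemma coeff_power_nonneg:
  fixes p :: "'a :: linordered_idom poly"
  assumes "\<And>i. coeff p i \<ge> 0"
  shows "coeff (p ^ n) i \<ge> 0"
proof (induction n arbitrary: i)
  case 0
  then show ?case by (cases i) auto
next
  case (Suc n)
  then show ?case using assms by (auto simp: coeff_mult intro!: sum_nonneg)
qed

lemma poly_ge_coeff_0:
  fixes p :: "'a :: linordered_idom poly"
  assumes "\<And>i. coeff p i \<ge> 0" and "y \<ge> 0"
  shows "coeff p 0 \<le> poly p y"
proof -
  have "coeff p 0 * y ^ 0 \<le> (\<Sum>i\<le>degree p. coeff p i * y ^ i)"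
    using assms by (intro member_le_sum) auto
  then show ?thesis by (simp add: poly_altdef)
qed

lemma higher_pderiv_power_pos:
  fixes y :: real
  assumes "y \<ge> 0"
  shows "poly ((pderiv ^^ n) ([:0, 1, 1:] ^ n)) y > 0"
proof -
  let ?r = "[:0, 1, 1:] ^ n :: real poly"
  have nonneg: "coeff ?r i \<ge> 0" for i
    by (rule coeff_power_nonneg) (auto simp: coeff_pCons split: nat.splits)
  have "?r = ([:0, 1:] * [:1, 1:]) ^ n" by simp
  also have "\<dots> = monom 1 n * [:1, 1:] ^ n"
    by (simp only: power_mult_distrib monom_altdef smult_1_left)
  finally have "coeff ?r n = coeff ([:1, 1:] ^ n) 0"
    by (simp add: coeff_monom_mult)
  also have "\<dots> = 1" by (simp add: coeff_0_power)
  finally have lead: "coeff ?r n = 1" .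
  have "0 < coeff ((pderiv ^^ n) ?r) 0"
    using pochhammer_pos[of "1::real" n] by (simp add: coeff_higher_pderiv lead)
  also have "\<dots> \<le> poly ((pderiv ^^ n) ?r) y"
    using assms nonneg
    by (intro poly_ge_coeff_0) (auto simp: coeff_higher_pderiv intro!: mult_nonneg_nonneg pochhammer_nonneg)
  finally show ?thesis .
qed

text \<open>
  Seen from either end point of the reference element, that is, after the substitution
  \<open>x = \<plusminus>(1/2 + y)\<close>, the polynomial \<open>x\<^sup>2 - 1/4\<close> becomes \<open>y\<^sup>2 + y\<close>.  The
  \<open>n\<close>-th derivative of its \<open>n\<close>-th power has nonnegative coefficients and a positive constant
  one, so it cannot vanish for \<open>y \<ge> 0\<close>.
\<close>
lemma legendre_ref_root_bound:
  assumes "poly (legendre_ref n) x = 0"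
  shows "\<bar>x\<bar> \<le> 1/2"
proof (rule ccontr)
  assume "\<not> \<bar>x\<bar> \<le> 1/2"
  (* the sign d selects the end point d / 2 beyond which x lies *)
  define d :: real where "d = (if x > 0 then 1 else -1)"
  define y where "y = \<bar>x\<bar> - 1/2"
  have y: "y \<ge> 0" and x: "x = d / 2 + y * d" and dd: "d * d = 1"
    using \<open>\<not> \<bar>x\<bar> \<le> 1/2\<close> by (auto simp: y_def d_def)
  let ?p = "[:- (1/4), 0, 1:] :: real poly"
  have "pcompose ?p [:d / 2, d:] = [:0, 1, 1:]"
    using dd by (simp add: pcompose_pCons algebra_simps)
  then have "pcompose (?p ^ n) [:d / 2, d:] = [:0, 1, 1:] ^ n"
    by (simp add: pcompose_power)
  then have "(pderiv ^^ n) ([:0, 1, 1:] ^ n)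
      = smult (d ^ n) (pcompose ((pderiv ^^ n) (?p ^ n)) [:d / 2, d:])"
    using higher_pderiv_pcompose_linear[of n "?p ^ n" "d / 2" d] by simp
  then have "poly ((pderiv ^^ n) ([:0, 1, 1:] ^ n)) y = d ^ n * poly ((pderiv ^^ n) (?p ^ n)) x"
    by (simp add: poly_pcompose x)
  moreover have "poly ((pderiv ^^ n) (?p ^ n)) x = 0"
    using assms by (simp add: legendre_ref_def)
  ultimately show False using higher_pderiv_power_pos[OF y, of n] by simp
qed

lemma x_node_in_domain:
  assumes "valid_discretization D" and "i \<in> elements D" and "p \<in> nodes D"
  shows "x_node D i p \<in> {x_left D..x_right D}"
proof -
  have "ref_node D p \<in> {x. poly (legendre_ref (degr D + 1)) x = 0}"
    using assms unfolding valid_discretization_def gauss_legendre_def nodes_def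
    by (meson bij_betwE)
  then have xi: "\<bar>ref_node D p\<bar> \<le> 1/2" using legendre_ref_root_bound by blast
  have N: "num_x D \<ge> 1" and lr: "x_left D < x_right D"
    using assms(1) by (auto simp: valid_discretization_def)
  then have h: "h_x D > 0" and Nh: "real (num_x D) * h_x D = x_right D - x_left D"
    by (auto simp: h_x_def)
  have i: "1 \<le> real i" "real i \<le> real (num_x D)"
    using assms(2) by (auto simp: elements_def)
  define t where "t = real i - 1/2 + ref_node D p"
  have t: "0 \<le> t" "t \<le> real (num_x D)" using xi i by (auto simp: t_def)
  have "x_node D i p = x_left D + t * h_x D"
    by (simp add: x_node_def x_center_def t_def algebra_simps)
  moreover have "0 \<le> t * h_x D" using t h by simp
  moreover have "t * h_x D \<le> real (num_x D) * h_x D" using t h by (simp add: mult_right_mono)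
  ultimately show ?thesis using Nh by auto
qed

section \<open>Functions bounded along a filter\<close>

lemma Bfun_add:
  fixes f g :: "'e \<Rightarrow> 'b::real_normed_vector"
  assumes "Bfun f F" and "Bfun g F"
  shows "Bfun (\<lambda>e. f e + g e) F"
proof -
  obtain K where "\<forall>\<^sub>F e in F. norm (f e) \<le> K" using assms(1) by (auto simp: Bfun_def)
  moreover obtain L where "\<forall>\<^sub>F e in F. norm (g e) \<le> L" using assms(2) by (auto simp: Bfun_def)
  ultimately have "\<forall>\<^sub>F e in F. norm (f e + g e) \<le> K + L"
    by eventually_elim (rule norm_triangle_mono)
  then show ?thesis by (rule BfunI)
qed

lemma Bfun_sum:
  fixes f :: "'x \<Rightarrow> 'e \<Rightarrow> 'b::real_normed_vector"
  assumes "\<And>x. x \<in> A \<Longrightarrow> Bfun (f x) F"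
  shows "Bfun (\<lambda>e. \<Sum>x\<in>A. f x e) F"
  using assms by (induction A rule: infinite_finite_induct) (auto intro: Bfun_add)

lemma (in bounded_linear) Bfun:
  assumes "Bfun g F"
  shows "Bfun (\<lambda>e. f (g e)) F"
proof -
  obtain L where L: "\<And>x. norm (f x) \<le> norm x * L" and "L \<ge> 0"
    using nonneg_bounded by blast
  obtain K where "\<forall>\<^sub>F e in F. norm (g e) \<le> K" using assms by (auto simp: Bfun_def)
  then have "\<forall>\<^sub>F e in F. norm (f (g e)) \<le> K * L"
    by eventually_elim (use L \<open>L \<ge> 0\<close> in \<open>meson mult_right_mono order_trans\<close>)
  then show ?thesis by (rule BfunI)
qed

lemmas Bfun_scaleR_right = bounded_linear.Bfun[OF bounded_linear_scaleR_right]
lemmas Bfun_scaleR_left = bounded_linear.Bfun[OF bounded_linear_scaleR_left]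
lemmas Bfun_mult_right = bounded_linear.Bfun[OF bounded_linear_mult_right]
lemmas Bfun_minus = bounded_linear.Bfun[OF bounded_linear_minus[OF bounded_linear_ident]]

lemma Bfun_diff:
  fixes f g :: "'e \<Rightarrow> 'b::real_normed_vector"
  assumes "Bfun f F" and "Bfun g F"
  shows "Bfun (\<lambda>e. f e - g e) F"
  using Bfun_add[OF assms(1) Bfun_minus[OF assms(2)]] by simp

lemma Bfun_eventually_le:
  fixes f :: "'e \<Rightarrow> 'a::real_normed_vector" and g :: "'e \<Rightarrow> 'b::real_normed_vector"
  assumes "Bfun g F" and "\<forall>\<^sub>F e in F. norm (f e) \<le> norm (g e)"
  shows "Bfun f F"
proof -
  obtain K where "\<forall>\<^sub>F e in F. norm (g e) \<le> K" using assms(1) by (auto simp: Bfun_def)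
  then have "\<forall>\<^sub>F e in F. norm (f e) \<le> K" using assms(2) by eventually_elim simp
  then show ?thesis by (rule BfunI)
qed

lemma Bfun_eventually_eq:
  fixes f g :: "'e \<Rightarrow> 'b::real_normed_vector"
  assumes "Bfun g F" and "\<forall>\<^sub>F e in F. f e = g e"
  shows "Bfun f F"
  by (rule Bfun_eventually_le[OF assms(1)]) (use assms(2) in eventually_elim, simp)

lemmas Bfun_arith_intros =
  Bfun_add Bfun_diff Bfun_mult_right Bfun_scaleR_right Bfun_scaleR_left Bfun_sum

section \<open>Boundedness of the explicit terms\<close>

abbreviation (input) interior_bounded :: "discretization \<Rightarrow> ('e \<Rightarrow> coeffs) \<Rightarrow> 'e filter \<Rightarrow> bool" where
  "interior_bounded D C F \<equiv>
     \<forall>i\<in>elements D. \<forall>p\<in>nodes D. \<forall>m\<in>vgrid D. \<forall>n\<in>vgrid D. Bfun (\<lambda>e. C e i p m n) F"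

text \<open>
  An admissible boundary condition takes one bound for all interior entries at once, so the
  finitely many separate bounds are first merged into one.
\<close>
lemma with_ghosts_bounded:
  assumes B: "admissible_bc D B" and C: "interior_bounded D C F"
    and "j \<le> num_x D + 1" "p \<in> nodes D" "m \<in> vgrid D" "n \<in> vgrid D"
  shows "Bfun (\<lambda>e. with_ghosts D B (C e) j p m n) F"
proof (cases "j \<in> elements D")
  case True
  then show ?thesis using assms by (simp add: with_ghosts_def)
next
  case False
  then have j: "j \<in> {0, num_x D + 1}" using assms(3) by (auto simp: elements_def)
  define S where "S e = (\<Sum>i\<in>elements D. \<Sum>p\<in>nodes D. \<Sum>m\<in>vgrid D. \<Sum>n\<in>vgrid D. \<bar>C e i p m n\<bar>)" for e
  have fin: "finite (elements D)" "finite (nodes D)" "finite (vgrid D)"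
    by (auto simp: elements_def nodes_def vgrid_def)
  have le_S: "\<bar>C e i p m n\<bar> \<le> S e"
    if "i \<in> elements D" "p \<in> nodes D" "m \<in> vgrid D" "n \<in> vgrid D" for e i p m n
  proof -
    have "\<bar>C e i p m n\<bar> \<le> (\<Sum>n\<in>vgrid D. \<bar>C e i p m n\<bar>)"
      using that fin by (intro member_le_sum) auto
    also have "\<dots> \<le> (\<Sum>m\<in>vgrid D. \<Sum>n\<in>vgrid D. \<bar>C e i p m n\<bar>)"
      using that fin by (intro member_le_sum sum_nonneg) auto
    also have "\<dots> \<le> (\<Sum>p\<in>nodes D. \<Sum>m\<in>vgrid D. \<Sum>n\<in>vgrid D. \<bar>C e i p m n\<bar>)"
      using that fin
      by (intro member_le_sum[where f = "\<lambda>p. \<Sum>m\<in>vgrid D. \<Sum>n\<in>vgrid D. \<bar>C e i p m n\<bar>"] sum_nonneg) auto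
    also have "\<dots> \<le> S e"
      unfolding S_def using that fin
      by (intro member_le_sum[where f = "\<lambda>i. \<Sum>p\<in>nodes D. \<Sum>m\<in>vgrid D. \<Sum>n\<in>vgrid D. \<bar>C e i p m n\<bar>"]
            sum_nonneg) auto
    finally show ?thesis .
  qed
  have "Bfun S F"
    unfolding S_def
  proof (intro Bfun_sum)
    fix i p m n
    assume "i \<in> elements D" "p \<in> nodes D" "m \<in> vgrid D" "n \<in> vgrid D"
    then have "Bfun (\<lambda>e. C e i p m n) F" using C by blast
    then show "Bfun (\<lambda>e. \<bar>C e i p m n\<bar>) F" by (rule Bfun_eventually_le) simp
  qed
  then obtain R where R: "\<forall>\<^sub>F e in F. norm (S e) \<le> R" by (auto simp: Bfun_def)
  obtain K where K:
    "\<forall>C'. (\<forall>i\<in>elements D. \<forall>p\<in>nodes D. \<forall>m\<in>vgrid D. \<forall>n\<in>vgrid D. \<bar>C' i p m n\<bar> \<le> R) \<longrightarrow>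
        (\<forall>i\<in>{0, num_x D + 1}. \<forall>p\<in>nodes D. \<forall>m\<in>vgrid D. \<forall>n\<in>vgrid D. \<bar>B C' i p m n\<bar> \<le> K)"
    using B[unfolded admissible_bc_def, THEN spec[of _ R]] by (rule exE)
  from R have "\<forall>\<^sub>F e in F. norm (with_ghosts D B (C e) j p m n) \<le> K"
  proof eventually_elim
    case (elim e)
    have "\<forall>i\<in>elements D. \<forall>p\<in>nodes D. \<forall>m\<in>vgrid D. \<forall>n\<in>vgrid D. \<bar>C e i p m n\<bar> \<le> R"
      using le_S[of _ _ _ _ e] elim(1) by fastforce
    from K[THEN spec, THEN mp, OF this] have "\<bar>B (C e) j p m n\<bar> \<le> K" using j assms(4-6) by blast
    then show ?case using False by (simp add: with_ghosts_def)
  qed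
  then show ?thesis by (rule BfunI)
qed

lemma dg_plus_bounded:
  fixes Z :: "'e \<Rightarrow> nat \<Rightarrow> nat \<Rightarrow> 'b::real_normed_vector"
  assumes "\<And>j q. j \<le> num_x D + 1 \<Longrightarrow> q \<in> nodes D \<Longrightarrow> Bfun (\<lambda>e. Z e j q) F"
    and "i \<in> elements D"
  shows "Bfun (\<lambda>e. dg_plus D (Z e) i p) F"
  unfolding dg_plus_def
  by (intro Bfun_arith_intros assms(1)) (use assms(2) in \<open>auto simp: elements_def\<close>)

lemma dg_minus_bounded:
  fixes Z :: "'e \<Rightarrow> nat \<Rightarrow> nat \<Rightarrow> 'b::real_normed_vector"
  assumes "\<And>j q. j \<le> num_x D + 1 \<Longrightarrow> q \<in> nodes D \<Longrightarrow> Bfun (\<lambda>e. Z e j q) F"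
    and "i \<in> elements D"
  shows "Bfun (\<lambda>e. dg_minus D (Z e) i p) F"
  unfolding dg_minus_def
  by (intro Bfun_arith_intros assms(1)) (use assms(2) in \<open>auto simp: elements_def\<close>)

lemma transport_bounded:
  assumes "admissible_bc D B" and "interior_bounded D C F"
    and "i \<in> elements D" "m \<in> vgrid D" "n \<in> vgrid D"
  shows "Bfun (\<lambda>e. transport D (with_ghosts D B (C e)) i p m n) F"
  unfolding transport_def
  by (intro Bfun_add Bfun_mult_right dg_plus_bounded dg_minus_bounded with_ghosts_bounded assms)

lemma moments_of_bounded:
  assumes "\<And>m n. m \<in> vgrid D \<Longrightarrow> n \<in> vgrid D \<Longrightarrow> Bfun (\<lambda>e. G e m n) F"
  shows "Bfun (\<lambda>e. moments_of D (G e)) F"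
  unfolding moments_of_def vel_sum_def by (intro Bfun_arith_intros assms)

lemma moment_transport_bounded:
  assumes "admissible_bc D B" and "interior_bounded D C F" and "i \<in> elements D"
  shows "Bfun (\<lambda>e. moment_transport D (with_ghosts D B (C e)) i p) F"
  unfolding moment_transport_def
proof (intro Bfun_add dg_plus_bounded dg_minus_bounded assms(3))
  fix j q assume jq: "j \<le> num_x D + 1" "q \<in> nodes D"
  note intros = Bfun_scaleR_right Bfun_sum Bfun_scaleR_left Bfun_mult_right
    with_ghosts_bounded assms(1,2) jq
  show "Bfun (\<lambda>e. flux_plus D (with_ghosts D B (C e) j q)) F"
    unfolding flux_plus_def vel_sum_def by (intro intros)
  show "Bfun (\<lambda>e. flux_minus D (with_ghosts D B (C e) j q)) F"
    unfolding flux_minus_def vel_sum_def by (intro intros)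
qed

section \<open>Boundedness of the corrected Maxwellian\<close>

text \<open>
  The entries of a Maxwellian all have the sign of \<open>n\<^sub>M\<close>, so there is no cancellation in the
  discrete density, which therefore controls each entry.
\<close>
lemma maxwellian_entry_le:
  assumes "qcm D U Q" and "m \<in> vgrid D" "n \<in> vgrid D"
  shows "(h_v D)\<^sup>2 * \<bar>maxwellian D Q m n\<bar> \<le> norm U"
proof -
  obtain nM ux uy T where Q: "Q = (nM, ux, uy, T)" by (cases Q)
  have T: "T > 0" and U: "moments_of D (maxwellian D Q) = U" using assms(1) by (auto simp: Q)
  have fin: "finite (vgrid D)" by (simp add: vgrid_def)
  have sign: "\<bar>maxwellian D Q a b\<bar> = sgn nM * maxwellian D Q a b" for a b
  proof -
    define c where "c = exp (- ((v_x D a - ux)\<^sup>2) / (2 * T)) * exp (- ((v_y D b - uy)\<^sup>2) / (2 * T)) / (2 * pi * T)"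
    have "c > 0" using T by (simp add: c_def)
    moreover have "maxwellian D Q a b = nM * c" by (simp add: Q c_def)
    ultimately show ?thesis by (simp add: abs_mult abs_sgn[of nM])
  qed
  have density: "fst U = (h_v D)\<^sup>2 * (\<Sum>a\<in>vgrid D. \<Sum>b\<in>vgrid D. maxwellian D Q a b)"
    by (simp add: U[symmetric] moments_of_def vel_sum_def invariants_def fst_sum)
  have "\<bar>maxwellian D Q m n\<bar> \<le> (\<Sum>b\<in>vgrid D. \<bar>maxwellian D Q m b\<bar>)"
    using assms fin by (intro member_le_sum) auto
  also have "\<dots> \<le> (\<Sum>a\<in>vgrid D. \<Sum>b\<in>vgrid D. \<bar>maxwellian D Q a b\<bar>)"
    using assms fin by (intro member_le_sum sum_nonneg) auto
  also have "\<dots> = sgn nM * (\<Sum>a\<in>vgrid D. \<Sum>b\<in>vgrid D. maxwellian D Q a b)"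
    by (simp add: sign sum_distrib_left)
  finally have "(h_v D)\<^sup>2 * \<bar>maxwellian D Q m n\<bar>
      \<le> (h_v D)\<^sup>2 * (sgn nM * (\<Sum>a\<in>vgrid D. \<Sum>b\<in>vgrid D. maxwellian D Q a b))"
    by (rule mult_left_mono) simp
  also have "\<dots> = sgn nM * fst U" by (simp add: density)
  also have "\<dots> \<le> \<bar>fst U\<bar>" by (auto simp: sgn_real_def intro: abs_ge_self abs_ge_minus_self)
  also have "\<dots> \<le> norm U" using norm_fst_le[of "fst U" "snd U"] by simp
  finally show ?thesis .
qed

lemma maxwellian_bounded:
  assumes "h_v D > 0" and "Bfun U F" and "\<forall>\<^sub>F e in F. qcm D (U e) (Q e)"
    and "m \<in> vgrid D" "n \<in> vgrid D"
  shows "Bfun (\<lambda>e. maxwellian D (Q e) m n) F"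
proof (rule Bfun_eventually_le)
  show "Bfun (\<lambda>e. (1 / (h_v D)\<^sup>2) *\<^sub>R U e) F" using assms(2) by (rule Bfun_scaleR_right)
  show "\<forall>\<^sub>F e in F. norm (maxwellian D (Q e) m n) \<le> norm ((1 / (h_v D)\<^sup>2) *\<^sub>R U e)"
    using assms(3)
  proof eventually_elim
    case (elim e)
    then show ?case using maxwellian_entry_le[OF elim assms(4,5)] assms(1)
      by (simp add: field_simps)
  qed
qed

section \<open>Relaxation in one implicit stage\<close>

text \<open>
  Solving the implicit equation for the stiff term \<open>(\<kappa> / \<epsilon>) (M - C)\<close> replaces the singular
  rate \<open>\<kappa> / \<epsilon>\<close> by \<open>\<kappa> / (\<epsilon> + \<kappa>) \<le> 1\<close>.  The stiff term is thus bounded by \<open>\<bar>M - X\<bar>\<close>, and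
  the deviation from equilibrium is \<open>\<epsilon> / \<kappa>\<close> times a bounded quantity.  Both conclusions are
  needed: the first because a later stage reuses the stiff term.
\<close>
lemma relaxation_limit:
  fixes C M X :: "'e \<Rightarrow> real"
  assumes "\<kappa> > 0" and pos: "\<forall>\<^sub>F e in F. \<epsilon> e > 0" and lim: "(\<epsilon> \<longlongrightarrow> 0) F"
    and X: "Bfun X F" and M: "Bfun M F"
    and eq: "\<forall>\<^sub>F e in F. C e = X e + \<kappa> / \<epsilon> e * (M e - C e)"
  shows "Bfun (\<lambda>e. \<kappa> / \<epsilon> e * (M e - C e)) F" and "((\<lambda>e. C e - M e) \<longlongrightarrow> 0) F"
proof -
  have MX: "Bfun (\<lambda>e. M e - X e) F" using M X by (rule Bfun_diff)
  have rate: "\<forall>\<^sub>F e in F. \<kappa> / \<epsilon> e * (M e - C e) = \<kappa> / (\<epsilon> e + \<kappa>) * (M e - X e)"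
    using pos eq
  proof eventually_elim
    case (elim e)
    define S where "S = \<kappa> / \<epsilon> e * (M e - C e)"
    have "\<kappa> * (M e - C e) = \<epsilon> e * S" using elim(1) by (simp add: S_def)
    moreover have "C e = X e + S" using elim(2) by (simp add: S_def)
    ultimately have "(\<epsilon> e + \<kappa>) * S = \<kappa> * (M e - X e)" by (simp add: algebra_simps)
    then have "S = \<kappa> / (\<epsilon> e + \<kappa>) * (M e - X e)"
      using elim(1) assms(1) by (simp add: nonzero_eq_divide_eq mult.commute)
    then show ?case by (simp only: S_def)
  qed
  show stiff: "Bfun (\<lambda>e. \<kappa> / \<epsilon> e * (M e - C e)) F"
  proof (rule Bfun_eventually_le[OF MX])
    show "\<forall>\<^sub>F e in F. norm (\<kappa> / \<epsilon> e * (M e - C e)) \<le> norm (M e - X e)"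
      using rate pos
    proof eventually_elim
      case (elim e)
      then have "\<bar>\<kappa> / (\<epsilon> e + \<kappa>)\<bar> \<le> 1" using assms(1) by simp
      then show ?case unfolding elim(1) by (simp only: real_norm_def abs_mult mult_left_le_one_le abs_ge_zero)
    qed
  qed
  have "Zfun (\<lambda>e. \<epsilon> e * (\<kappa> / \<epsilon> e * (M e - C e))) F"
    using lim by (intro bounded_bilinear.Zfun_prod_Bfun[OF bounded_bilinear_mult _ stiff])
      (simp add: tendsto_Zfun_iff)
  then have "((\<lambda>e. \<epsilon> e * (\<kappa> / \<epsilon> e * (M e - C e))) \<longlongrightarrow> 0) F"
    by (simp add: tendsto_Zfun_iff)
  then have "((\<lambda>e. - (1 / \<kappa>) * (\<epsilon> e * (\<kappa> / \<epsilon> e * (M e - C e)))) \<longlongrightarrow> 0) F"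
    by (rule tendsto_mult_right_zero)
  moreover have "\<forall>\<^sub>F e in F. - (1 / \<kappa>) * (\<epsilon> e * (\<kappa> / \<epsilon> e * (M e - C e))) = C e - M e"
    using pos by eventually_elim (use assms(1) in simp)
  ultimately show "((\<lambda>e. C e - M e) \<longlongrightarrow> 0) F" by (rule Lim_transform_eventually)
qed

section \<open>The asymptotic limit of the scheme\<close>

theorem proposition1:
  fixes D :: discretization
    and B0 B1 :: boundary_condition
    and dt :: real
    and F :: "'e filter"
    and \<epsilon> :: "'e \<Rightarrow> real \<Rightarrow> real"
    and C0 C1 C2 :: "'e \<Rightarrow> coeffs"
    and U1 U2 :: "'e \<Rightarrow> nat \<Rightarrow> nat \<Rightarrow> moments"
    and Q1 Q2 :: "'e \<Rightarrow> nat \<Rightarrow> nat \<Rightarrow> maxwell_param"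
  assumes "valid_discretization D"
    and "admissible_bc D B0" and "admissible_bc D B1"
    and "dt > 0"
    and eps_pos: "\<forall>\<^sub>F e in F. \<forall>x\<in>{x_left D..x_right D}. \<epsilon> e x > 0"
    and eps_lim: "\<forall>i\<in>elements D. \<forall>p\<in>nodes D. ((\<lambda>e. \<epsilon> e (x_node D i p)) \<longlongrightarrow> 0) F"
    and C0_bdd: "\<forall>i\<in>elements D. \<forall>p\<in>nodes D. \<forall>m\<in>vgrid D. \<forall>n\<in>vgrid D.
                   Bfun (\<lambda>e. C0 e i p m n) F"
    and scheme: "\<forall>\<^sub>F e in F. imex_step D B0 B1 dt (\<epsilon> e) (C0 e)
                   (U1 e) (Q1 e) (C1 e) (U2 e) (Q2 e) (C2 e)"
  shows "\<forall>i\<in>elements D. \<forall>p\<in>nodes D. \<forall>m\<in>vgrid D. \<forall>n\<in>vgrid D.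
           ((\<lambda>e. C2 e i p m n - maxwellian D (Q2 e i p) m n) \<longlongrightarrow> 0) F"
proof -
  let ?G0 = "\<lambda>e. with_ghosts D B0 (C0 e)" and ?G1 = "\<lambda>e. with_ghosts D B1 (C1 e)"
  let ?\<delta> = imex_delta
  define \<kappa> where "\<kappa> = imex_gamma * dt"
  have "sqrt 2 < 2" using real_sqrt_less_mono[of 2 4] by simp
  then have gamma: "imex_gamma > 0" by (simp add: imex_gamma_def)
  then have kappa: "\<kappa> > 0" using \<open>dt > 0\<close> by (simp add: \<kappa>_def)
  have hv: "h_v D > 0" using assms(1) by (simp add: valid_discretization_def)
  note step = scheme[unfolded imex_step_def Let_def]

  have pos: "\<forall>\<^sub>F e in F. \<epsilon> e (x_node D i p) > 0" if "i \<in> elements D" "p \<in> nodes D" for i p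
    using eps_pos by eventually_elim (use x_node_in_domain[OF assms(1) that] in blast)

  have M1: "Bfun (\<lambda>e. maxwellian D (Q1 e i p) m n) F"
    if ip: "i \<in> elements D" "p \<in> nodes D" and mn: "m \<in> vgrid D" "n \<in> vgrid D" for i p m n
  proof (rule maxwellian_bounded[OF hv _ _ mn])
    have "Bfun (\<lambda>e. moments_of D (C0 e i p) + \<kappa> *\<^sub>R moment_transport D (?G0 e) i p) F"
      using C0_bdd ip assms(2)
      by (intro Bfun_add Bfun_scaleR_right moments_of_bounded moment_transport_bounded) auto
    moreover have "\<forall>\<^sub>F e in F. U1 e i p
        = moments_of D (C0 e i p) + \<kappa> *\<^sub>R moment_transport D (?G0 e) i p"
      using step by eventually_elim (use ip in \<open>simp add: \<kappa>_def\<close>)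
    ultimately show "Bfun (\<lambda>e. U1 e i p) F" by (rule Bfun_eventually_eq)
    show "\<forall>\<^sub>F e in F. qcm D (U1 e i p) (Q1 e i p)"
      using step by eventually_elim (use ip in blast)
  qed

  define X1 where "X1 e i p m n = C0 e i p m n + \<kappa> * transport D (?G0 e) i p m n" for e i p m n
  define S1 where "S1 e i p m n
      = \<kappa> / \<epsilon> e (x_node D i p) * (maxwellian D (Q1 e i p) m n - C1 e i p m n)" for e i p m n
  have T0: "Bfun (\<lambda>e. transport D (?G0 e) i p m n) F"
    if "i \<in> elements D" "m \<in> vgrid D" "n \<in> vgrid D" for i p m n
    using transport_bounded[OF assms(2) C0_bdd that] .
  have X1: "Bfun (\<lambda>e. X1 e i p m n) F"
    if "i \<in> elements D" "p \<in> nodes D" "m \<in> vgrid D" "n \<in> vgrid D" for i p m n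
    unfolding X1_def using C0_bdd that by (intro Bfun_add Bfun_mult_right T0) auto
  have stage1: "\<forall>\<^sub>F e in F. C1 e i p m n = X1 e i p m n + S1 e i p m n"
    if "i \<in> elements D" "p \<in> nodes D" "m \<in> vgrid D" "n \<in> vgrid D" for i p m n
    using step unfolding X1_def S1_def \<kappa>_def by eventually_elim (use that in blast)
  have S1: "Bfun (\<lambda>e. S1 e i p m n) F"
    if "i \<in> elements D" "p \<in> nodes D" "m \<in> vgrid D" "n \<in> vgrid D" for i p m n
    using relaxation_limit(1)[OF kappa pos[OF that(1,2)] eps_lim[rule_format, OF that(1,2)]
        X1[OF that] M1[OF that] stage1[OF that, unfolded S1_def]]
    unfolding S1_def .
  have C1: "interior_bounded D C1 F"
    by (intro ballI Bfun_eventually_eq[OF Bfun_add[OF X1 S1] stage1])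

  show ?thesis
  proof (intro ballI)
    fix i p m n
    assume ip: "i \<in> elements D" "p \<in> nodes D" and mn: "m \<in> vgrid D" "n \<in> vgrid D"
    have M2: "Bfun (\<lambda>e. maxwellian D (Q2 e i p) m n) F"
    proof (rule maxwellian_bounded[OF hv _ _ mn])
      have "Bfun (\<lambda>e. moments_of D (C0 e i p) + (?\<delta> * dt) *\<^sub>R moment_transport D (?G0 e) i p
          + ((1 - ?\<delta>) * dt) *\<^sub>R moment_transport D (?G1 e) i p) F"
        using C0_bdd C1 ip assms(2,3)
        by (intro Bfun_add Bfun_scaleR_right moments_of_bounded moment_transport_bounded) auto
      moreover have "\<forall>\<^sub>F e in F. U2 e i p
          = moments_of D (C0 e i p) + (?\<delta> * dt) *\<^sub>R moment_transport D (?G0 e) i p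
            + ((1 - ?\<delta>) * dt) *\<^sub>R moment_transport D (?G1 e) i p"
        using step by eventually_elim (use ip in blast)
      ultimately show "Bfun (\<lambda>e. U2 e i p) F" by (rule Bfun_eventually_eq)
      show "\<forall>\<^sub>F e in F. qcm D (U2 e i p) (Q2 e i p)"
        using step by eventually_elim (use ip in blast)
    qed
    define X2 where "X2 e = C0 e i p m n + ?\<delta> * dt * transport D (?G0 e) i p m n
      + (1 - ?\<delta>) * dt * transport D (?G1 e) i p m n
      + (1 - imex_gamma) / imex_gamma * S1 e i p m n" for e
    have X2: "Bfun X2 F"
      unfolding X2_def using C0_bdd C1 ip mn assms(3)
      by (intro Bfun_add Bfun_mult_right T0 S1 transport_bounded) auto
    have "\<forall>\<^sub>F e in F. C2 e i p m n
        = X2 e + \<kappa> / \<epsilon> e (x_node D i p) * (maxwellian D (Q2 e i p) m n - C2 e i p m n)"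
      using step
    proof eventually_elim
      case (elim e)
      (* S1 contains the factor gamma * dt, whereas the second stage weights the same
         difference with (1 - gamma) * dt. *)
      have "(1 - imex_gamma) * dt / \<epsilon> e (x_node D i p) * (maxwellian D (Q1 e i p) m n - C1 e i p m n)
          = (1 - imex_gamma) / imex_gamma * S1 e i p m n"
        using gamma by (simp add: S1_def \<kappa>_def)
      moreover have "C2 e i p m n = C0 e i p m n + ?\<delta> * dt * transport D (?G0 e) i p m n
          + (1 - ?\<delta>) * dt * transport D (?G1 e) i p m n
          + (1 - imex_gamma) * dt / \<epsilon> e (x_node D i p) * (maxwellian D (Q1 e i p) m n - C1 e i p m n)
          + imex_gamma * dt / \<epsilon> e (x_node D i p) * (maxwellian D (Q2 e i p) m n - C2 e i p m n)"
        using elim ip mn by blast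
      ultimately show ?case by (simp only: X2_def \<kappa>_def)
    qed
    then show "((\<lambda>e. C2 e i p m n - maxwellian D (Q2 e i p) m n) \<longlongrightarrow> 0) F"
      by (rule relaxation_limit(2)[OF kappa pos[OF ip] eps_lim[rule_format, OF ip] X2 M2])
  qed
qed

end
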